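(* Let $0<\Omega<\Delta$ be integers with $\gcd(\Delta,\Omega)=1$. If the cyclic quotient singularity $\frac1\Delta(1,\Omega)$ admits two extremal P-resolutions, then the invariants $\delta$ of these two extremal P-resolutions are equal.
   Context: Work over $\mathbb C$. The cyclic quotient singularity $\frac1n(1,a)$ is the germ at the origin of the quotient of $\mathbb A^2$ by $\mu_n$ acting by $(x,y)\mapsto(\zeta x,\zeta^ay)$. A Wahl singularity is a cyclic quotient singularity $\frac1{m^2}(1,ma-1)$ with $\gcd(m,a)=1$. An extremal P-resolution of a cyclic quotient singularity $(Q\in Y)$ is a partial resolution $f_0^+\colon(C^+\subset X^+)\to(Q\in Y)$ such that $X^+$ has only Wahl singularities (possibly none), the exceptional curve is $C^+\simeq\mathbb P^1$, and $K_{X^+}$ is relatively ample. Such an $X^+$ has at most two singular points $\frac1{m_i^2}(1,m_ia_i-1)$, $i=1,2$, and writing Hirzebruch--Jung continued fractions $[b_1,\dots,b_r]=b_1-1/(b_2-1/(\cdots-1/b_r))$, one has $\frac{m_1^2}{m_1a_1-1}=[e_1,\dots,e_{r_1}]$, $\frac{m_2^2}{m_2a_2-1}=[f_1,\dots,f_{r_2}]$ and $\frac\Delta\Omega=[f_{r_2},\dots,f_1,c,e_1,\dots,e_{r_1}]$, where $-c$ is the self-intersection of the proper transform of $C^+$ in the minimal resolution of $X^+$. If one (or both) of the points is smooth, set $m_i=a_i=1$ (and the corresponding chain is empty). The invariant $\delta$ of the extremal P-resolution is $$\delta=cm_1m_2-m_1a_2-m_2a_1,$$ equivalently $K_{X^+}\cdot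 C^+=\delta/(m_1m_2)$. *)

theory Defs
  imports Complex_Main
begin

text \<open>
  Everything is expressed through the exceptional curves of the minimal resolution of
  the partial resolution X+ of the cyclic quotient singularity (1/Delta)(1,Omega).
  These curves form a chain E(0), ..., E(r-1) of smooth rational curves, in which
  consecutive curves meet transversally in one point and non-consecutive ones are disjoint.
  The chain is recorded by the list of the integers \<open>b\<^sub>i = - E(i)\<^sup>2\<close>.
\<close>

subsection \<open>Hirzebruch--Jung continued fractions\<close>

text \<open>
  \<open>hirzebruch_jung [b\<^sub>1, \<dots>, b\<^sub>r] x\<close>: the continued fraction
  \<open>b\<^sub>1 - 1/(b\<^sub>2 - 1/(\<dots> - 1/b\<^sub>r))\<close> has the value x, and no division by zero occurs in it.
  A relation is used instead of a function because entries equal to 1 are allowed, so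
  that a tail may vanish.
\<close>
inductive hirzebruch_jung :: "int list \<Rightarrow> rat \<Rightarrow> bool" where
  single: "hirzebruch_jung [b] (of_int b)"
| cons: "hirzebruch_jung bs x \<Longrightarrow> x \<noteq> 0 \<Longrightarrow> hirzebruch_jung (b # bs) (of_int b - 1 / x)"

subsection \<open>Wahl singularities\<close>

text \<open>
  The exceptional chain of the minimal resolution of the Wahl singularity
  \<open>(1/m\<^sup>2)(1, m a - 1)\<close>, with a normalised to \<open>0 < a < m\<close>.
\<close>
definition wahl_chain :: "int \<Rightarrow> int \<Rightarrow> int list \<Rightarrow> bool" where
  "wahl_chain m a bs \<longleftrightarrow>
     0 < a \<and> a < m \<and> coprime m a \<and> (\<forall>b\<in>set bs. 2 \<le> b) \<and>
     hirzebruch_jung bs (of_int (m\<^sup>2) / of_int (m * a - 1))"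

text \<open>The convention for a smooth point is \<open>m = a = 1\<close> with the empty chain.\<close>
definition wahl_or_smooth :: "int \<Rightarrow> int \<Rightarrow> int list \<Rightarrow> bool" where
  "wahl_or_smooth m a bs \<longleftrightarrow> wahl_chain m a bs \<or> (m = 1 \<and> a = 1 \<and> bs = [])"

subsection \<open>Intersection numbers\<close>

text \<open>The intersection number of E(i) and E(j).\<close>
definition chain_int :: "int list \<Rightarrow> nat \<Rightarrow> nat \<Rightarrow> int" where
  "chain_int bs i j =
     (if i = j then - (bs ! i) else if j = Suc i \<or> i = Suc j then 1 else 0)"

text \<open>
  The intersection number of \<open>K + \<Sum>\<^sub>i d\<^sub>i E(i)\<close> with E(j), where K is the canonical class of
  the minimal resolution; adjunction for a smooth rational curve gives
  \<open>K \<cdot> E(j) = - 2 - E(j)\<^sup>2 = b\<^sub>j - 2\<close>.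
\<close>
definition pullback_canonical_int :: "int list \<Rightarrow> (nat \<Rightarrow> rat) \<Rightarrow> nat \<Rightarrow> rat" where
  "pullback_canonical_int bs d j =
     of_int (bs ! j - 2) + (\<Sum>i<length bs. d i * of_int (chain_int bs i j))"

text \<open>
  Let \<open>\<pi>\<close> be the contraction of all curves E(j) with \<open>j \<noteq> k\<close>. By definition,
  \<open>\<pi>\<^sup>* K = K + \<Sum>\<^sub>i d\<^sub>i E(i)\<close> where only contracted curves occur in the sum and the
  intersection with each contracted curve is zero. By the projection formula, the canonical
  class of the contracted surface has positive degree on the image of E(k) iff \<open>\<pi>\<^sup>* K \<cdot> E(k) > 0\<close>;
  since that image is the only exceptional curve over the singularity, this is relative ampleness.
\<close>
definition canonical_ample_on :: "int list \<Rightarrow> nat \<Rightarrow> bool" where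
  "canonical_ample_on bs k \<longleftrightarrow>
     (\<exists>d. d k = 0 \<and>
          (\<forall>j<length bs. j \<noteq> k \<longrightarrow> pullback_canonical_int bs d j = 0) \<and>
          pullback_canonical_int bs d k > 0)"

subsection \<open>Extremal P-resolutions\<close>

text \<open>
  The two points of C+ carry \<open>(m\<^sub>1, a\<^sub>1)\<close> with chain \<open>e\<^sub>1, \<dots>, e\<^sub>r\<close>, and \<open>(m\<^sub>2, a\<^sub>2)\<close> with chain
  \<open>f\<^sub>1, \<dots>, f\<^sub>s\<close>; the curves of index 1 are those that meet the proper transform of C+, whose
  self-intersection is \<open>- c\<close>.
\<close>
record p_resolution =
  m1 :: int
  a1 :: int
  es :: "int list"
  m2 :: int
  a2 :: int
  fs :: "int list"
  cc :: int

definition total_chain :: "p_resolution \<Rightarrow> int list" where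
  "total_chain X = rev (fs X) @ [cc X] @ es X"

text \<open>
  The proper transform of C+ is the curve of index \<open>length (fs X)\<close> in the total chain. It is
  contracted to a point of Y, so that \<open>c > 0\<close>; the value \<open>c = 1\<close> is possible.
\<close>
definition extremal_P_resolution :: "int \<Rightarrow> int \<Rightarrow> p_resolution \<Rightarrow> bool" where
  "extremal_P_resolution \<Delta> \<Omega> X \<longleftrightarrow>
     wahl_or_smooth (m1 X) (a1 X) (es X) \<and>
     wahl_or_smooth (m2 X) (a2 X) (fs X) \<and>
     cc X > 0 \<and>
     hirzebruch_jung (total_chain X) (of_int \<Delta> / of_int \<Omega>) \<and>
     canonical_ample_on (total_chain X) (length (fs X))"

definition delta :: "p_resolution \<Rightarrow> int" where
  "delta X = cc X * m1 X * m2 X - m1 X * a2 X - m2 X * a1 X"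

end

theory Submission
  imports Defs
begin

text \<open>
  The reason is Noether's formula. In a partial resolution X of Y with one exceptional curve C,
  the class K is numerically a multiple of C locally over Y, and \<open>K \<cdot> C = \<delta>/(m\<^sub>1 m\<^sub>2)\<close> together with
  \<open>C\<^sup>2 = - \<Delta>/(m\<^sub>1 m\<^sub>2)\<^sup>2\<close> gives the local self-intersection \<open>K\<^sup>2 = - \<delta>\<^sup>2/\<Delta>\<close>. On the other hand
  \<open>K\<^sup>2\<close> can be computed on the minimal resolution of X. Blowing up a smooth point lowers \<open>K\<^sup>2\<close>
  by 1 and creates one exceptional curve, so that \<open>K\<^sup>2\<close> plus the number of exceptional curves
  is the same for all resolutions of Y. Resolving a Wahl singularity does not change this sum
  either. Hence \<open>K\<^sup>2 + 1\<close> on X is an invariant of Y, so \<open>\<delta>\<^sup>2\<close> depends on Y alone, and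
  ampleness selects the positive root.

  The proof carries this out with integers. For a chain \<open>b\<^sub>1, \<dots>, b\<^sub>r\<close> with
  \<open>\<Delta>/\<Omega> = [b\<^sub>1, \<dots>, b\<^sub>r]\<close>, let \<open>\<Omega>'\<close> be the continuant of \<open>b\<^sub>1, \<dots>, b\<^sub>r\<^sub>-\<^sub>1\<close>. Solving for the
  discrepancies yields
  \<open>K\<^sup>2 + r = 2 - (\<Sum>(b\<^sub>i - 3) + (\<Omega> + \<Omega>' + 2)/\<Delta>)\<close>,
  so that the invariant part is the integer \<open>\<Sum>(b\<^sub>i - 3) \<cdot> \<Delta> + \<Omega>'\<close>, called \<open>noether\<close> below. It is
  determined by \<open>\<Delta>\<close> and \<open>\<Omega>\<close> (\<open>noether_determined\<close>): contracting curves with \<open>b = 1\<close> preserves it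
  (\<open>blow_down\<close>), and a continued fraction with all entries at least 2 is unique
  (\<open>minimal_chain_unique\<close>). Wahl chains satisfy \<open>\<Sum>(b\<^sub>i - 3) = 1\<close>, with all four continuants
  explicit polynomials in m and a (\<open>wahl_chain_exists\<close>). Substituting these into the chain of X
  turns \<open>K\<^sup>2 = - \<delta>\<^sup>2/\<Delta>\<close> into the polynomial identity \<open>\<delta>\<^sup>2 = noether - \<Delta> + \<Omega> + 2\<close>
  (\<open>extremal_P_resolution_invariants\<close>).
\<close>

section \<open>Continuants\<close>

fun num den :: "int list \<Rightarrow> int" where
  "num [] = 1"
| "num (b # bs) = b * num bs - den bs"
| "den [] = 0"
| "den (b # bs) = num bs"

text \<open>
  The continuants of the chain without its last entry, as \<open>continuants_snoc\<close> shows. They obey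
  the same recursion as \<open>num\<close> and \<open>den\<close>, which forces the starting value \<open>- 1\<close>:
  the matrix with rows \<open>(num, - init_num)\<close> and \<open>(den, - init_den)\<close> is the product of the matrices
  with rows \<open>(b, - 1)\<close> and \<open>(1, 0)\<close>, and it is the identity for the empty chain.
\<close>
fun init_num init_den :: "int list \<Rightarrow> int" where
  "init_num [] = 0"
| "init_num (b # bs) = b * init_num bs - init_den bs"
| "init_den [] = - 1"
| "init_den (b # bs) = init_num bs"

lemma continuant_det: "init_num bs * den bs - num bs * init_den bs = 1"
  by (induction bs) (auto simp: algebra_simps)

lemma coprime_num_den: "coprime (num bs) (den bs)"
proof (rule coprimeI)
  fix d assume "d dvd num bs" "d dvd den bs"
  then have "d dvd init_num bs * den bs - num bs * init_den bs" by simp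
  then show "is_unit d" by (simp add: continuant_det)
qed

text \<open>
  Expansion of the continuants at the joint of two chains. The left chain is read outwards from
  the joint, as the chain \<open>f\<^sub>1, \<dots>, f\<^sub>s\<close> of an extremal P-resolution is read outwards from \<open>C\<^sup>+\<close>.
\<close>
lemma continuants_rev_append:
  "num (rev ls @ xs) = num ls * num xs - den ls * den xs"
  "den (rev ls @ xs) = init_num ls * num xs - init_den ls * den xs"
  "init_num (rev ls @ xs) = num ls * init_num xs - den ls * init_den xs"
  "init_den (rev ls @ xs) = init_num ls * init_num xs - init_den ls * init_den xs"
  by (induction ls arbitrary: xs) (simp_all, simp_all add: algebra_simps)

lemma continuants_rev:
  "num (rev bs) = num bs" "den (rev bs) = init_num bs"
  "init_num (rev bs) = den bs" "init_den (rev bs) = init_den bs"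
  using continuants_rev_append[of bs "[]"] by simp_all

lemma continuants_snoc:
  "num (bs @ [b]) = b * num bs - init_num bs"
  "den (bs @ [b]) = b * den bs - init_den bs"
  "init_num (bs @ [b]) = num bs"
  "init_den (bs @ [b]) = den bs"
  by (induction bs) (simp_all, simp_all add: algebra_simps)

text \<open>
  Prepending entries acts linearly on the pairs \<open>(num, den)\<close> and \<open>(init_num, init_den)\<close> by the same
  matrix, so a relation between two tails propagates. The case \<open>k = 0\<close> serves blow-downs
  inside a chain, \<open>k = 1\<close> blow-downs at its end, where the last curve is lost.
\<close>
lemma continuants_append_shift:
  assumes "num ys = num zs" "den ys = den zs"
    and "init_num ys = init_num zs + k * num zs" "init_den ys = init_den zs + k * den zs"
  shows "num (xs @ ys) = num (xs @ zs) \<and> den (xs @ ys) = den (xs @ zs) \<and>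
         init_num (xs @ ys) = init_num (xs @ zs) + k * num (xs @ zs) \<and>
         init_den (xs @ ys) = init_den (xs @ zs) + k * den (xs @ zs)"
  using assms by (induction xs) (simp_all add: algebra_simps)

lemma hirzebruch_jung_value:
  "hirzebruch_jung bs x \<Longrightarrow> den bs \<noteq> 0 \<and> x = of_int (num bs) / of_int (den bs)"
proof (induction rule: hirzebruch_jung.induct)
  case (single b)
  then show ?case by simp
next
  case (cons bs x b)
  then have "num bs \<noteq> 0" by auto
  with cons show ?case by (simp add: field_simps)
qed

lemma hirzebruch_jung_num_den:
  assumes hj: "hirzebruch_jung bs (of_int p / of_int q)"
    and pq: "coprime p q" "0 < p" "0 < q" and pos: "0 < num bs"
  shows "num bs = p" "den bs = q"
proof -
  have d0: "den bs \<noteq> 0" and "of_int p / of_int q = (of_int (num bs) / of_int (den bs) :: rat)"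
    using hirzebruch_jung_value[OF hj] by auto
  then have "of_int (p * den bs) = (of_int (num bs * q) :: rat)"
    using pq by (simp add: field_simps)
  then have eq: "p * den bs = num bs * q" by (simp only: of_int_eq_iff)
  have "p dvd num bs * q" "num bs dvd p * den bs"
    by (metis eq dvd_triv_left)+
  then have "p dvd num bs" "num bs dvd p"
    using pq(1) coprime_num_den[of bs]
    by (simp_all add: coprime_dvd_mult_left_iff)
  then show "num bs = p" using pos pq(2) by (simp add: zdvd_antisym_nonneg)
  with eq pq show "den bs = q" by simp
qed

section \<open>Minimal and positive chains\<close>

lemma minimal_den_less_num:
  "\<forall>b\<in>set bs. 2 \<le> b \<Longrightarrow> 0 \<le> den bs \<and> den bs < num bs"
proof (induction bs)
  case (Cons b bs)
  then have less: "0 \<le> den bs" "den bs < num bs" by auto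
  have "2 \<le> b" "0 \<le> num bs" using less Cons.prems by auto
  then have "2 * num bs \<le> b * num bs" by (rule mult_right_mono)
  with less show ?case unfolding num.simps den.simps by (intro conjI; linarith)
qed simp

text \<open>
  If all entries are at least 2, the tail has a value greater than 1, so the first entry is the
  value of the chain rounded up and can be read off.
\<close>
lemma minimal_chain_unique:
  assumes "\<forall>b\<in>set xs. 2 \<le> b" "\<forall>b\<in>set ys. 2 \<le> b" "num xs = num ys" "den xs = den ys"
  shows "xs = ys"
  using assms
proof (induction xs arbitrary: ys)
  case Nil
  then show ?case using minimal_den_less_num[of "tl ys"] by (cases ys) auto
next
  case (Cons x xs)
  have x: "0 \<le> den xs" "den xs < num xs"
    using minimal_den_less_num[of xs] Cons.prems by auto
  then obtain y zs where ys: "ys = y # zs" using Cons.prems by (cases ys) auto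
  have y: "0 \<le> den zs" "den zs < num zs"
    using minimal_den_less_num[of zs] Cons.prems ys by auto
  have n: "num zs = num xs" using Cons.prems ys by simp
  have eq: "(x - y) * num xs = den xs - den zs"
    using Cons.prems ys n by (simp add: algebra_simps)
  have "x = y"
  proof (rule ccontr)
    assume "x \<noteq> y"
    then have "1 \<le> \<bar>x - y\<bar>" by simp
    then have "num xs \<le> \<bar>x - y\<bar> * num xs" using x by (simp add: mult_le_cancel_right1)
    also have "\<dots> = \<bar>den xs - den zs\<bar>" using eq x by (metis abs_mult abs_of_pos le_less_trans)
    finally show False using x y n by linarith
  qed
  with eq have "den xs = den zs" by simp
  have "xs = zs"
    by (rule Cons.IH) (use Cons.prems ys n \<open>den xs = den zs\<close> in simp_all)
  with ys \<open>x = y\<close> show ?case by simp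
qed

text \<open>
  The numerators of the tails are minors of the negated intersection matrix, taken along a flag
  of sub-chains. Their positivity is Sylvester's criterion: the chain is negative definite.
\<close>
fun positive_chain :: "int list \<Rightarrow> bool" where
  "positive_chain [] \<longleftrightarrow> True"
| "positive_chain (b # bs) \<longleftrightarrow> positive_chain bs \<and> 0 < num (b # bs)"

lemma positive_chain_num: "positive_chain bs \<Longrightarrow> 0 < num bs"
  by (cases bs) auto

lemma positive_chain_den: "positive_chain bs \<Longrightarrow> 0 \<le> den bs"
  by (cases bs) (auto dest: positive_chain_num)

lemma positive_chain_appendD: "positive_chain (xs @ ys) \<Longrightarrow> positive_chain ys"
  by (induction xs) auto

lemma positive_chain_entries:
  assumes "positive_chain bs" shows "\<forall>b\<in>set bs. 1 \<le> b"
  using assms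
proof (induction bs)
  case (Cons b bs)
  then have "0 < b * num bs" "0 < num bs"
    using positive_chain_num[of bs] positive_chain_den[of bs] by auto
  with Cons show ?case by (auto simp: zero_less_mult_iff)
qed simp

lemma minimal_positive_chain: "\<forall>b\<in>set bs. 2 \<le> b \<Longrightarrow> positive_chain bs"
proof (induction bs)
  case (Cons b bs)
  then show ?case using minimal_den_less_num[of "b # bs"] by auto
qed simp

lemma positive_chain_append_cong:
  assumes "positive_chain (xs @ ys)" "positive_chain zs" "num ys = num zs" "den ys = den zs"
  shows "positive_chain (xs @ zs)"
proof -
  have nd: "num (ws @ ys) = num (ws @ zs) \<and> den (ws @ ys) = den (ws @ zs)" for ws
    using assms by (induction ws) auto
  show ?thesis using assms nd by (induction xs) auto
qed

text \<open>
  With entries \<open>g \<ge> 2\<close>, the recursion \<open>n\<^sub>i\<^sub>+\<^sub>1 = g n\<^sub>i - n\<^sub>i\<^sub>-\<^sub>1\<close> of the numerators can never recover: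
  once a numerator fails to be positive it lies below its predecessor, and the sequence decreases
  from there on. Thus positivity of the last numerator alone implies that of all the others.
\<close>
lemma positive_chain_extend:
  assumes "\<forall>g\<in>set gs. 2 \<le> g" "positive_chain xs" "0 < num (gs @ xs)"
  shows "positive_chain (gs @ xs)"
proof -
  have desc: "\<forall>g\<in>set hs. 2 \<le> g \<Longrightarrow> num (hs @ xs) \<le> 0 \<Longrightarrow> num (hs @ xs) < den (hs @ xs)" for hs
  proof (induction hs)
    case Nil
    then show ?case using positive_chain_num[OF assms(2)] by simp
  next
    case (Cons h hs)
    show ?case
    proof (cases "num (hs @ xs) \<le> 0")
      case True
      with Cons have "num (hs @ xs) < den (hs @ xs)" "h * num (hs @ xs) \<le> 2 * num (hs @ xs)"
        by (auto intro: mult_right_mono_neg)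
      then show ?thesis by simp
    qed (use Cons.prems in simp)
  qed
  show ?thesis using assms(1,3)
  proof (induction gs)
    case Nil
    then show ?case using assms(2) by simp
  next
    case (Cons g gs)
    have "0 < num (gs @ xs)"
    proof (rule ccontr)
      assume neg: "\<not> 0 < num (gs @ xs)"
      then have "num (gs @ xs) < den (gs @ xs)" using desc[of gs] Cons.prems by simp
      moreover have "g * num (gs @ xs) \<le> 2 * num (gs @ xs)"
        using neg Cons.prems(1) by (intro mult_right_mono_neg) auto
      moreover have "den (gs @ xs) < g * num (gs @ xs)" using Cons.prems(2) by simp
      ultimately show False using neg by linarith
    qed
    with Cons show ?case by auto
  qed
qed

section \<open>Invariance of \<open>K\<^sup>2\<close> plus the number of curves\<close>

definition excess :: "int list \<Rightarrow> int" where
  "excess bs = (\<Sum>b\<leftarrow>bs. b - 3)"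

lemma excess_simps [simp]:
  "excess [] = 0" "excess (b # bs) = b - 3 + excess bs"
  "excess (xs @ ys) = excess xs + excess ys" "excess (rev xs) = excess xs"
  by (simp_all add: excess_def flip: rev_map)

text \<open>
  With \<open>\<Delta> = num bs\<close> and \<open>\<Omega> = den bs\<close>, the value of \<open>K\<^sup>2\<close> on the surface with exceptional chain
  \<open>bs\<close> satisfies \<open>K\<^sup>2 + length bs = 2 - (noether bs + \<Omega> + 2)/\<Delta>\<close>.
\<close>
definition noether :: "int list \<Rightarrow> int" where
  "noether bs = excess bs * num bs + init_num bs"

text \<open>
  Contracting the curve with \<open>b = 1\<close> lowers the entries of its neighbours by 1. Inside a chain
  the continuants do not change, and the excess keeps its value since
  \<open>a + 1 + b - 9 = (a - 1) + (b - 1) - 6\<close>. At the end of a chain the excess grows by 1 and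
  \<open>init_num\<close> drops by \<open>num\<close>; these two effects cancel in \<open>noether\<close>.
\<close>
lemma blow_down:
  assumes "positive_chain (xs @ a # 1 # ys)"
  obtains zs where "length zs = length (xs @ a # ys)" "positive_chain zs"
    "num zs = num (xs @ a # 1 # ys)" "den zs = den (xs @ a # 1 # ys)"
    "noether zs = noether (xs @ a # 1 # ys)"
proof -
  have suffix: "positive_chain (a # 1 # ys)" by (rule positive_chain_appendD[OF assms])
  show thesis
  proof (cases ys)
    case Nil
    show thesis
    proof (rule that[of "xs @ [a - 1]"])
      have "num (xs @ [a, 1]) = num (xs @ [a - 1]) \<and> den (xs @ [a, 1]) = den (xs @ [a - 1]) \<and>
            init_num (xs @ [a, 1]) = init_num (xs @ [a - 1]) + 1 * num (xs @ [a - 1]) \<and>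
            init_den (xs @ [a, 1]) = init_den (xs @ [a - 1]) + 1 * den (xs @ [a - 1])"
        by (rule continuants_append_shift) simp_all
      then show "num (xs @ [a - 1]) = num (xs @ a # 1 # ys)"
        "den (xs @ [a - 1]) = den (xs @ a # 1 # ys)"
        "noether (xs @ [a - 1]) = noether (xs @ a # 1 # ys)"
        by (simp_all add: Nil noether_def algebra_simps)
      show "positive_chain (xs @ [a - 1])"
        by (rule positive_chain_append_cong[OF assms]) (use suffix Nil in simp_all)
    qed (simp add: Nil)
  next
    case (Cons b us)
    show thesis
    proof (rule that[of "xs @ (a - 1) # (b - 1) # us"])
      have "num (xs @ a # 1 # ys) = num (xs @ (a - 1) # (b - 1) # us) \<and>
            den (xs @ a # 1 # ys) = den (xs @ (a - 1) # (b - 1) # us) \<and>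
            init_num (xs @ a # 1 # ys) = init_num (xs @ (a - 1) # (b - 1) # us)
              + 0 * num (xs @ (a - 1) # (b - 1) # us) \<and>
            init_den (xs @ a # 1 # ys) = init_den (xs @ (a - 1) # (b - 1) # us)
              + 0 * den (xs @ (a - 1) # (b - 1) # us)"
        by (rule continuants_append_shift) (simp_all add: Cons algebra_simps)
      then show "num (xs @ (a - 1) # (b - 1) # us) = num (xs @ a # 1 # ys)"
        "den (xs @ (a - 1) # (b - 1) # us) = den (xs @ a # 1 # ys)"
        "noether (xs @ (a - 1) # (b - 1) # us) = noether (xs @ a # 1 # ys)"
        by (simp_all add: Cons noether_def)
      show "positive_chain (xs @ (a - 1) # (b - 1) # us)"
        by (rule positive_chain_append_cong[OF assms])
          (use suffix Cons in \<open>simp_all add: algebra_simps\<close>)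
    qed (simp add: Cons)
  qed
qed

text \<open>
  As long as some entry is 1, a blow-down shortens the chain. That entry is never the first
  one, because a chain starting with 1 has a value of at most 1.
\<close>
lemma minimal_model:
  assumes "positive_chain bs" "den bs < num bs"
  obtains zs where "\<forall>b\<in>set zs. 2 \<le> b" "num zs = num bs" "den zs = den bs"
    "noether zs = noether bs"
  using assms
proof (induction "length bs" arbitrary: bs thesis rule: less_induct)
  case less
  show ?case
  proof (cases "\<forall>b\<in>set bs. 2 \<le> b")
    case True
    then show ?thesis by (rule less.prems(1)) simp_all
  next
    case False
    then obtain b where "b \<in> set bs" "b < 2" by auto
    with positive_chain_entries[OF less.prems(2)] have "1 \<in> set bs"
      by (metis dual_order.antisym zless_add1_eq one_add_one linorder_not_less)
    then obtain us ys where bs: "bs = us @ 1 # ys" by (meson split_list)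
    have "us \<noteq> []"
    proof
      assume "us = []"
      with bs less.prems have "positive_chain ys" "num ys - den ys > num ys" by auto
      then show False using positive_chain_den[of ys] by simp
    qed
    then obtain xs a where "us = xs @ [a]" by (metis rev_exhaust)
    with bs have bs': "bs = xs @ a # 1 # ys" by simp
    obtain zs where zs: "length zs = length (xs @ a # ys)" "positive_chain zs"
      "num zs = num bs" "den zs = den bs" "noether zs = noether bs"
      using blow_down[of xs a ys] less.prems(2) unfolding bs' by metis
    then have "length zs < length bs" by (simp add: bs')
    then show ?thesis
      by (rule less.hyps) (use zs less.prems in auto)
  qed
qed

lemma noether_determined:
  assumes "positive_chain xs" "positive_chain ys" "den xs < num xs"
    and "num xs = num ys" "den xs = den ys"
  shows "noether xs = noether ys"
proof -
  obtain us where us: "\<forall>b\<in>set us. 2 \<le> b" "num us = num xs" "den us = den xs"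
    "noether us = noether xs"
    using minimal_model[OF assms(1,3)] .
  have "den ys < num ys" using assms(3-5) by simp
  from minimal_model[OF assms(2) this] obtain vs where vs: "\<forall>b\<in>set vs. 2 \<le> b"
    "num vs = num ys" "den vs = den ys" "noether vs = noether ys" .
  have "us = vs" using minimal_chain_unique[OF us(1) vs(1)] us vs assms(4,5) by simp
  then show ?thesis using us(4) vs(4) by simp
qed

section \<open>Wahl chains\<close>

text \<open>
  Wahl's algorithm: every Wahl chain arises from the chain \<open>[4]\<close> by raising the entry at one end
  and attaching a 2 at the other end, which keeps the excess equal to 1. If \<open>2 a < m\<close>, the chain
  for \<open>(m, a)\<close> is obtained in this way from that for \<open>(m - a, a)\<close>; reversing a chain exchanges a and
  \<open>m - a\<close>, which covers \<open>2 a > m\<close>.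
\<close>
lemma wahl_chain_exists:
  assumes "0 < a" "a < m" "coprime m a"
  shows "\<exists>bs. (\<forall>b\<in>set bs. 2 \<le> b) \<and> num bs = m\<^sup>2 \<and> den bs = m * a - 1 \<and>
    init_num bs = m * (m - a) - 1 \<and> init_den bs = m * a - 1 - a\<^sup>2 \<and> excess bs = 1"
    (is "\<exists>bs. ?W m a bs")
  using assms
proof (induction "nat m" arbitrary: m a rule: less_induct)
  case less
  have left_half: "\<exists>bs. ?W m a bs" if a: "0 < a" "2 * a < m" "coprime m a" for a
  proof -
    have "coprime (m - a) a" using a(3) by (simp add: coprime_iff_gcd_eq_1 gcd_diff1)
    then obtain bs where W: "?W (m - a) a bs" using less.hyps[of "m - a" a] a by auto
    then obtain b cs where bs: "bs = b # cs" by (cases bs) auto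
    have "?W m a (((b + 1) # cs) @ [2])"
      using W unfolding bs by (simp add: continuants_snoc power2_eq_square algebra_simps)
    then show ?thesis by blast
  qed
  consider "2 * a < m" | "m < 2 * a" | "m = 2 * a" by linarith
  then show ?case
  proof cases
    case 1
    then show ?thesis using left_half less.prems by blast
  next
    case 2
    have "coprime m (m - a)"
      by (metis less.prems(3) coprime_commute coprime_iff_gcd_eq_1 gcd_diff2)
    then obtain bs where "?W m (m - a) bs" using left_half[of "m - a"] 2 less.prems by auto
    then have "?W m a (rev bs)"
      by (simp add: continuants_rev power2_eq_square algebra_simps)
    then show ?thesis by blast
  next
    case 3
    then have "a = 1" using less.prems by simp
    then have "?W m a [4]" using 3 by simp
    then show ?thesis by blast
  qed
qed

text \<open>
  The number s is 0 for a Wahl singularity and 1 for a smooth point. The empty chain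
  deviates from the Wahl formulas by s times \<open>(num, den)\<close> in \<open>(init_num, init_den)\<close> and by \<open>- s\<close> in
  the excess, and these deviations cancel in \<open>noether\<close>, so that smooth points need no case
  distinction later on.
\<close>
lemma wahl_or_smooth_continuants:
  assumes "wahl_or_smooth m a bs"
  obtains s where "0 < a" "a \<le> m" "\<forall>b\<in>set bs. 2 \<le> b"
    "num bs = m\<^sup>2" "den bs = m * a - 1"
    "init_num bs = m * (m - a) - 1 + s * num bs" "init_den bs = m * a - 1 - a\<^sup>2 + s * den bs"
    "excess bs = 1 - s"
proof (cases "wahl_chain m a bs")
  case True
  then have ma: "0 < a" "a < m" "coprime m a" and min: "\<forall>b\<in>set bs. 2 \<le> b"
    and hj: "hirzebruch_jung bs (of_int (m\<^sup>2) / of_int (m * a - 1))"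
    by (auto simp: wahl_chain_def)
  obtain ws where W: "\<forall>b\<in>set ws. 2 \<le> b" "num ws = m\<^sup>2" "den ws = m * a - 1"
    "init_num ws = m * (m - a) - 1" "init_den ws = m * a - 1 - a\<^sup>2" "excess ws = 1"
    using wahl_chain_exists[OF ma] by blast
  have "1 * 2 \<le> a * m" using ma by (intro mult_mono) auto
  then have "0 < m * a - 1" by (simp add: mult.commute)
  moreover have "coprime (m\<^sup>2) (m * a - 1)" using coprime_num_den[of ws] W by simp
  moreover have "0 < num bs" using minimal_den_less_num[OF min] by simp
  ultimately have "num bs = m\<^sup>2" "den bs = m * a - 1"
    using hirzebruch_jung_num_den[OF hj] ma by simp_all
  then have "bs = ws" using minimal_chain_unique[OF min W(1)] W by simp
  then show ?thesis using that[of 0] ma W by simp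
next
  case False
  then have "m = 1" "a = 1" "bs = []" using assms by (auto simp: wahl_or_smooth_def)
  then show ?thesis using that[of 1] by simp
qed

section \<open>Ampleness\<close>

lemma pullback_canonical_int_eq:
  assumes "j < length bs"
  shows "pullback_canonical_int bs d j = of_int (bs ! j - 2) - d j * of_int (bs ! j)
    + (if j = 0 then 0 else d (j - 1)) + (if Suc j < length bs then d (Suc j) else 0)"
proof -
  let ?n = "length bs"
  have "(\<Sum>i<?n. d i * of_int (chain_int bs i j)) =
    (\<Sum>i<?n. (if i = j then - d j * of_int (bs ! j) else 0)
       + (if Suc i = j then d i else 0) + (if i = Suc j then d i else 0))"
    by (rule sum.cong) (auto simp: chain_int_def)
  also have "\<dots> = - d j * of_int (bs ! j) + (\<Sum>i<?n. if Suc i = j then d i else 0)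
      + (if Suc j < ?n then d (Suc j) else 0)"
    using assms by (simp add: sum.distrib)
  also have "(\<Sum>i<?n. if Suc i = j then d i else 0) = (if j = 0 then 0 else d (j - 1))"
    using assms by (cases j) simp_all
  finally show ?thesis by (simp add: pullback_canonical_int_def)
qed

text \<open>
  A solution of the three-term recurrence along a chain is determined by its two boundary values;
  this is the resulting value next to the boundary, by Cramer's rule.
\<close>
lemma chain_recurrence_solution:
  fixes g :: "nat \<Rightarrow> rat"
  assumes "\<And>i. i < length bs \<Longrightarrow> of_int (bs ! i) * g (Suc i) = g i + g (Suc (Suc i))"
  shows "of_int (num bs) * g 1 = of_int (den bs) * g 0 + g (Suc (length bs))"
  using assms
proof (induction bs arbitrary: g)
  case (Cons b bs)
  have "of_int (num bs) * g 2 = of_int (den bs) * g 1 + g (Suc (Suc (length bs)))"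
    using Cons.IH[of "\<lambda>i. g (Suc i)"] Cons.prems[of "Suc _"] by (simp add: numeral_2_eq_2)
  moreover have "of_int b * g 1 = g 0 + g 2"
    using Cons.prems[of 0] by (simp add: numeral_2_eq_2)
  ultimately have "of_int (num bs) * (of_int b * g 1) =
      of_int (num bs) * g 0 + of_int (den bs) * g 1 + g (Suc (Suc (length bs)))"
    by (simp add: algebra_simps)
  then show ?case by (simp add: algebra_simps)
qed simp

text \<open>
  If \<open>d\<close> are the coefficients in \<open>\<pi>\<^sup>* K\<close>, the log discrepancies \<open>1 - d\<close> satisfy the homogeneous
  equations \<open>b\<^sub>i g\<^sub>i = g\<^sub>i\<^sub>-\<^sub>1 + g\<^sub>i\<^sub>+\<^sub>1\<close> with the value 1 on \<open>C\<^sup>+\<close> and beyond the end of the chain: the inhomogeneous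
  terms \<open>b\<^sub>i - 2\<close> of adjunction are absorbed by the shift. The numbers \<open>g\<close> and \<open>h\<close> are the log
  discrepancies of the two curves that meet \<open>C\<^sup>+\<close>, and \<open>\<pi>\<^sup>* K \<cdot> C\<^sup>+ = c - g - h\<close>.
\<close>
lemma canonical_ample_log_discrepancies:
  fixes ls rs :: "int list" and c :: int
  defines "T \<equiv> rev ls @ c # rs"
  assumes "canonical_ample_on T (length ls)"
  obtains g h :: rat where "of_int (num rs) * g = of_int (den rs + 1)"
    "of_int (num ls) * h = of_int (den ls + 1)" "g + h < of_int c"
proof -
  let ?k = "length ls"
  obtain d where dk: "d ?k = 0"
    and zero: "\<And>j. j < length T \<Longrightarrow> j \<noteq> ?k \<Longrightarrow> pullback_canonical_int T d j = 0"
    and pos: "0 < pullback_canonical_int T d ?k"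
    using assms(2) by (auto simp: canonical_ample_on_def)
  have len: "length T = length ls + 1 + length rs" by (simp add: T_def)
  \<comment> \<open>The index runs outwards from \<open>C\<^sup>+\<close> on both sides; past the last curve the value is 1, which
     stands for the absent neighbour.\<close>
  define g where "g i = (if i \<le> length rs then 1 - d (?k + i) else 1)" for i
  define h where "h i = (if i \<le> length ls then 1 - d (?k - i) else 1)" for i
  have "of_int (num rs) * g 1 = of_int (den rs) * g 0 + g (Suc (length rs))"
  proof (rule chain_recurrence_solution)
    fix i assume i: "i < length rs"
    have "T ! Suc (?k + i) = rs ! i" by (simp add: T_def nth_append)
    then show "of_int (rs ! i) * g (Suc i) = g i + g (Suc (Suc i))"
      using zero[of "Suc (?k + i)"] i len
      by (auto simp: pullback_canonical_int_eq g_def algebra_simps)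
  qed
  moreover have "of_int (num ls) * h 1 = of_int (den ls) * h 0 + h (Suc (length ls))"
  proof (rule chain_recurrence_solution)
    fix i assume i: "i < length ls"
    then obtain r where r: "?k = Suc (i + r)" by (metis less_imp_Suc_add)
    then have "T ! r = ls ! i" by (simp add: T_def nth_append rev_nth)
    then show "of_int (ls ! i) * h (Suc i) = h i + h (Suc (Suc i))"
      using zero[of r] r len
      by (cases r) (auto simp: pullback_canonical_int_eq h_def algebra_simps)
  qed
  moreover have "g 1 + h 1 < of_int c"
  proof -
    have "T ! ?k = c" by (simp add: T_def nth_append)
    then show ?thesis
      using pos len dk
      by (auto simp: pullback_canonical_int_eq g_def h_def Suc_le_eq split: if_splits)
  qed
  moreover have "g 0 = 1" "h 0 = 1" "g (Suc (length rs)) = 1" "h (Suc (length ls)) = 1"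
    using dk by (simp_all add: g_def h_def)
  ultimately show thesis using that[of "g 1" "h 1"] by simp
qed

section \<open>The invariant \<open>\<delta>\<close>\<close>

text \<open>
  Ampleness gives \<open>a\<^sub>1/m\<^sub>1 + a\<^sub>2/m\<^sub>2 < c\<close>, which is \<open>\<delta> > 0\<close>. Then the numerator of the total chain,
  \<open>m\<^sub>1\<^sup>2 + m\<^sub>2\<^sup>2 + \<delta> m\<^sub>1 m\<^sub>2\<close>, is positive, so it equals \<open>\<Delta>\<close> and not \<open>- \<Delta>\<close>, and the whole chain is
  negative definite. The last formula is \<open>K\<^sup>2 = - \<delta>\<^sup>2/\<Delta>\<close>, combined with \<open>K\<^sup>2 + 1 = 2 - (noether + \<Omega> + 2)/\<Delta>\<close>.
\<close>
lemma extremal_P_resolution_invariants: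
  assumes pr: "0 < \<Omega>" "\<Omega> < \<Delta>" "coprime \<Delta> \<Omega>" and X: "extremal_P_resolution \<Delta> \<Omega> X"
  defines "T \<equiv> total_chain X"
  shows "positive_chain T" "num T = \<Delta>" "den T = \<Omega>" "0 < delta X"
    "(delta X)\<^sup>2 = noether T - \<Delta> + \<Omega> + 2"
proof -
  obtain m a n b c rs ls where fields: "m1 X = m" "a1 X = a" "m2 X = n" "a2 X = b" "cc X = c"
    "es X = rs" "fs X = ls" by blast
  have T: "T = rev ls @ c # rs" by (simp add: T_def total_chain_def fields)
  have X': "wahl_or_smooth m a rs" "wahl_or_smooth n b ls" "0 < c"
    "hirzebruch_jung T (of_int \<Delta> / of_int \<Omega>)" "canonical_ample_on T (length ls)"
    using X by (auto simp: extremal_P_resolution_def fields T_def)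
  obtain s where e: "0 < a" "a \<le> m" "\<forall>b\<in>set rs. 2 \<le> b"
    "num rs = m\<^sup>2" "den rs = m * a - 1"
    "init_num rs = m * (m - a) - 1 + s * num rs" "init_den rs = m * a - 1 - a\<^sup>2 + s * den rs"
    "excess rs = 1 - s"
    using wahl_or_smooth_continuants[OF X'(1)] .
  obtain t where f: "0 < b" "b \<le> n" "\<forall>b\<in>set ls. 2 \<le> b"
    "num ls = n\<^sup>2" "den ls = n * b - 1"
    "init_num ls = n * (n - b) - 1 + t * num ls" "init_den ls = n * b - 1 - b\<^sup>2 + t * den ls"
    "excess ls = 1 - t"
    using wahl_or_smooth_continuants[OF X'(2)] .
  have delta: "delta X = c * m * n - m * b - n * a" by (simp add: delta_def fields)
  obtain g h :: rat where gh: "of_int (num rs) * g = of_int (den rs + 1)"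
    "of_int (num ls) * h = of_int (den ls + 1)" "g + h < of_int c"
    using canonical_ample_log_discrepancies X'(5) unfolding T by blast
  have mn: "0 < m" "0 < n" using e f by auto
  have "g = of_int a / of_int m" "h = of_int b / of_int n"
    using gh(1,2) mn by (auto simp: e f field_simps power2_eq_square)
  with gh(3) mn have "of_int (a * n + b * m) < (of_int (c * m * n) :: rat)"
    by (simp add: field_simps)
  then have "a * n + b * m < c * m * n" by (simp only: of_int_less_iff)
  then show pos: "0 < delta X" by (simp add: delta algebra_simps)
  have "num T = m\<^sup>2 + n\<^sup>2 + delta X * (m * n)"
    by (simp add: T continuants_rev_append e f delta power2_eq_square algebra_simps)
  then have numT: "0 < num T" using pos mn by (simp add: add_pos_pos)
  have "m * a \<le> m * m" "m * m \<le> c * (m * m)" using e mn X'(3) by simp_all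
  then have "positive_chain (c # rs)"
    using minimal_positive_chain[OF e(3)] by (simp add: e power2_eq_square)
  then show "positive_chain T"
    using positive_chain_extend[of "rev ls"] f(3) numT by (simp add: T)
  show nd: "num T = \<Delta>" "den T = \<Omega>"
    using hirzebruch_jung_num_den[OF X'(4) pr(3)] pr numT by simp_all
  have "(delta X)\<^sup>2 = noether T - num T + den T + 2"
    unfolding noether_def delta
    by (simp add: T continuants_rev_append e f power2_eq_square) algebra
  then show "(delta X)\<^sup>2 = noether T - \<Delta> + \<Omega> + 2" by (simp add: nd)
qed

theorem theorem4p4:
  fixes \<Delta> \<Omega> :: int and X X' :: p_resolution
  assumes "0 < \<Omega>" and "\<Omega> < \<Delta>" and "coprime \<Delta> \<Omega>"
    and "extremal_P_resolution \<Delta> \<Omega> X"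
    and "extremal_P_resolution \<Delta> \<Omega> X'"
  shows "delta X = delta X'"
proof -
  note inv = extremal_P_resolution_invariants[OF assms(1-3) assms(4)]
  note inv' = extremal_P_resolution_invariants[OF assms(1-3) assms(5)]
  have "noether (total_chain X) = noether (total_chain X')"
    by (rule noether_determined) (use inv inv' assms(2) in simp_all)
  then have "(delta X)\<^sup>2 = (delta X')\<^sup>2" using inv(5) inv'(5) by simp
  then show ?thesis using inv(4) inv'(4) by (simp add: power2_eq_iff_nonneg)
qed

end
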